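(* Let $C$ be a non-empty finite set and let $\Gamma$ be a subgroup of the symmetric group $S(C)$. Then $\Gamma$ is fully cancelling if and only if $\Gamma$ is the trivial subgroup $\{\mathrm{id}_C\}$.
   Context: Composition of functions is written $p \lhd q$ ("$p$ then $q$"), meaning $(p\lhd q)(x)=q(p(x))$. For sets $A,B$, a bijection $f:A\times C\to B\times C$, and $(\alpha,\beta,\gamma)\in S(A)\times S(B)\times \Gamma$, define $f_{\alpha,\beta,\gamma}=(\alpha^{-1}\times\gamma^{-1})\lhd f\lhd(\beta\times\gamma)$, and for a bijection $h:A\to B$ define $h_{\alpha,\beta}=\alpha^{-1}\lhd h\lhd\beta$. A bijection $h:A\to B$ is a $\Gamma$-equivariant quotient of $f$ if for every $(\alpha,\beta,\gamma)\in S(A)\times S(B)\times\Gamma$ with $f_{\alpha,\beta,\gamma}=f$ one has $h_{\alpha,\beta}=h$. The group $\Gamma$ is fully cancelling if for all sets $A,B$ (possibly infinite), every bijection $f:A\times C\to B\times C$ has a $\Gamma$-equivariant quotient. *)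

theory Defs
  imports "HOL-Algebra.Bij"
begin

text \<open>
  The symmetric group \<open>S(X)\<close> is \<^term>\<open>BijGroup X\<close>, with carrier \<^term>\<open>Bij X\<close>: the bijections of
  \<open>X\<close> that are \<^const>\<open>undefined\<close> outside \<open>X\<close>. Its product is \<open>g \<circ> f\<close>, the opposite of the
  diagrammatic composition \<open>p\<close> then \<open>q\<close> = \<open>q \<circ> p\<close>; both products have the same subgroups.
  Maps \<open>A \<times> C \<rightarrow> B \<times> C\<close> and \<open>A \<rightarrow> B\<close> are total HOL functions whose values off the domain are
  irrelevant, so they are compared on the domain only.
\<close>

definition twist_prod ::
  "'a set \<Rightarrow> 'c set \<Rightarrow> ('a \<Rightarrow> 'a) \<Rightarrow> ('b \<Rightarrow> 'b) \<Rightarrow> ('c \<Rightarrow> 'c) \<Rightarrow> ('a \<times> 'c \<Rightarrow> 'b \<times> 'c) \<Rightarrow> 'a \<times> 'c \<Rightarrow> 'b \<times> 'c"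
  where "twist_prod A C \<alpha> \<beta> \<gamma> f =
    map_prod \<beta> \<gamma> \<circ> f \<circ> map_prod (inv_into A \<alpha>) (inv_into C \<gamma>)"

definition twist :: "'a set \<Rightarrow> ('a \<Rightarrow> 'a) \<Rightarrow> ('b \<Rightarrow> 'b) \<Rightarrow> ('a \<Rightarrow> 'b) \<Rightarrow> 'a \<Rightarrow> 'b"
  where "twist A \<alpha> \<beta> h = \<beta> \<circ> h \<circ> inv_into A \<alpha>"

definition equivariant_quotient ::
  "'a set \<Rightarrow> 'b set \<Rightarrow> 'c set \<Rightarrow> ('c \<Rightarrow> 'c) set \<Rightarrow> ('a \<times> 'c \<Rightarrow> 'b \<times> 'c) \<Rightarrow> ('a \<Rightarrow> 'b) \<Rightarrow> bool"
  where "equivariant_quotient A B C \<Gamma> f h \<longleftrightarrow>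
    bij_betw h A B \<and>
    (\<forall>\<alpha>\<in>Bij A. \<forall>\<beta>\<in>Bij B. \<forall>\<gamma>\<in>\<Gamma>.
      (\<forall>x\<in>A \<times> C. twist_prod A C \<alpha> \<beta> \<gamma> f x = f x) \<longrightarrow> (\<forall>a\<in>A. twist A \<alpha> \<beta> h a = h a))"

text \<open>
  HOL cannot quantify over all sets of all types inside a formula. The two type arguments are the
  universes from which \<open>A\<close> and \<open>B\<close> are drawn.
\<close>

definition fully_cancelling ::
  "'a itself \<Rightarrow> 'b itself \<Rightarrow> 'c set \<Rightarrow> ('c \<Rightarrow> 'c) set \<Rightarrow> bool"
  where "fully_cancelling T U C \<Gamma> \<longleftrightarrow>
    (\<forall>(A :: 'a set) (B :: 'b set) f. bij_betw f (A \<times> C) (B \<times> C) \<longrightarrow>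
      (\<exists>h. equivariant_quotient A B C \<Gamma> f h))"

end

theory Submission
  imports Defs
begin

text \<open>
  For trivial \<open>\<Gamma>\<close>, replace \<open>A\<close> and \<open>B\<close> by sets of representatives for the orbits of the group of pairs
  \<open>(\<alpha>, \<beta>)\<close> that fix \<open>f\<close>. Since the \<open>C\<close>-coordinates are not moved, \<open>f\<close> still induces a bijection.
  It is a bipartite multigraph, regular of degree \<open>card C\<close>, so Hall's theorem for locally finite
  graphs in both directions and the Schroeder-Bernstein argument give a perfect matching. A matching
  is a choice of \<open>m \<in> C\<close> for each orbit, and \<open>a \<mapsto> fst (f (a, m))\<close> is then an equivariant quotient.

  For nontrivial \<open>\<Gamma>\<close>, take \<open>\<gamma> \<in> \<Gamma>\<close> having a nontrivial orbit \<open>Q \<subseteq> C\<close> on which its powers act freely. Let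
  \<open>\<gamma>\<close> act trivially on \<open>\<nat>\<close>. Both \<open>(\<nat> + Q) \<times> C\<close> and \<open>\<nat> \<times> C\<close> contain infinitely many copies of \<open>Q\<close>
  and \<open>Q \<times> C\<close> is a finite union of such copies, so there is an equivariant bijection between them.
  There is none between \<open>\<nat> + Q\<close> and \<open>\<nat>\<close>, because \<open>\<gamma>\<close> moves the points of \<open>Q\<close>.
\<close>

section \<open>Transversals of locally finite families\<close>

text \<open>The family is coded as a set of edges so that one edge can be deleted. As
  \<open>card\<close> of an infinite set is 0, the condition has its usual meaning when every index
  has finitely many neighbours.\<close>

definition hall :: "'i set \<Rightarrow> ('i \<times> 'b) set \<Rightarrow> bool"
  where "hall I E \<longleftrightarrow> (\<forall>J\<subseteq>I. finite J \<longrightarrow> card J \<le> card (E `` J))"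

text \<open>Zorn is applied to the sets of removed edges. A finite \<open>J\<close> has finitely
  many edges, so one member of a chain already removes every edge at \<open>J\<close> that the union
  removes.\<close>

lemma hall_maximal_removal:
  assumes fin: "\<And>i. i \<in> I \<Longrightarrow> finite (E `` {i})" and hall: "hall I E"
  obtains F where "F \<subseteq> E" "hall I F" "\<And>e. e \<in> F \<Longrightarrow> \<not> hall I (F - {e})"
proof -
  define \<A> where "\<A> = {D. D \<subseteq> E \<and> hall I (E - D)}"
  have "\<exists>M\<in>\<A>. \<forall>X\<in>\<A>. M \<subseteq> X \<longrightarrow> X = M"
  proof (rule subset_Zorn_nonempty)
    show "\<A> \<noteq> {}"
      using hall by (auto simp: \<A>_def intro!: exI[of _ "{}"])
    fix \<C> assume \<C>: "\<C> \<noteq> {}" "subset.chain \<A> \<C>"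
    then have sub: "\<C> \<subseteq> \<A>"
      by (simp add: subset.chain_def)
    have "card J \<le> card ((E - \<Union>\<C>) `` J)" if J: "J \<subseteq> I" "finite J" for J
    proof -
      let ?S = "E \<inter> J \<times> UNIV"
      have "?S \<subseteq> Sigma J (\<lambda>i. E `` {i})"
        by auto
      moreover have "finite (Sigma J (\<lambda>i. E `` {i}))"
        using J fin by (intro finite_SigmaI) auto
      ultimately have "finite (?S \<inter> \<Union>\<C>)"
        using finite_subset by blast
      then obtain D where D: "D \<in> \<C>" "?S \<inter> \<Union>\<C> \<subseteq> D"
        using finite_subset_Union_chain[of "?S \<inter> \<Union>\<C>" \<C> \<A>] \<C> by auto
      have "(E - \<Union>\<C>) `` J = (E - D) `` J"
        using D by auto
      moreover have "hall I (E - D)"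
        using D sub by (auto simp: \<A>_def)
      ultimately show ?thesis
        using J by (simp add: hall_def)
    qed
    moreover have "\<Union>\<C> \<subseteq> E"
      using sub by (auto simp: \<A>_def)
    ultimately show "\<Union>\<C> \<in> \<A>"
      by (simp add: \<A>_def hall_def)
  qed
  then obtain M where M: "M \<in> \<A>" and max: "\<And>X. X \<in> \<A> \<Longrightarrow> M \<subseteq> X \<Longrightarrow> X = M"
    by blast
  show thesis
  proof (rule that[of "E - M"])
    show "hall I (E - M)"
      using M by (simp add: \<A>_def)
    fix e assume e: "e \<in> E - M"
    show "\<not> hall I (E - M - {e})"
    proof
      assume "hall I (E - M - {e})"
      moreover have "E - M - {e} = E - insert e M"
        by blast
      ultimately have "insert e M \<in> \<A>"
        using M e by (auto simp: \<A>_def)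
      then show False
        using max[of "insert e M"] e by blast
    qed
  qed auto
qed

text \<open>Submodularity of \<open>J \<mapsto> card (F `` J)\<close>, applied to the two sets of indices at which Hall's
  condition breaks when one of two edges at \<open>i\<close> is removed (Rado).\<close>
lemma hall_minimal_single_valued:
  assumes fin: "\<And>i. i \<in> I \<Longrightarrow> finite (F `` {i})" and hall: "hall I F"
    and min: "\<And>e. e \<in> F \<Longrightarrow> \<not> hall I (F - {e})"
    and i: "i \<in> I" and y: "(i, y) \<in> F" and z: "(i, z) \<in> F"
  shows "y = z"
proof (rule ccontr)
  assume "y \<noteq> z"
  \<comment> \<open>Deleting \<open>(i, w)\<close> breaks Hall's condition at some finite set, which
    contains \<open>i\<close> because only the edges at \<open>i\<close> changed. Dropping
    \<open>i\<close> from it turns the strict inequality into \<open>\<le>\<close>.\<close>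
  have ex: "\<exists>J. J \<subseteq> I \<and> finite J \<and> i \<notin> J \<and> card (F `` J \<union> (F `` {i} - {w})) \<le> card J"
    if w: "(i, w) \<in> F" for w
  proof -
    obtain J where J: "J \<subseteq> I" "finite J" "card ((F - {(i, w)}) `` J) < card J"
      using min[OF w] by (auto simp: hall_def not_le)
    have "i \<in> J"
    proof (rule ccontr)
      assume "i \<notin> J"
      then have "(F - {(i, w)}) `` J = F `` J"
        by auto
      then show False
        using J hall by (simp add: hall_def leD)
    qed
    then have "(F - {(i, w)}) `` J = F `` (J - {i}) \<union> (F `` {i} - {w})"
      by auto
    then show ?thesis
      using J \<open>i \<in> J\<close> by (intro exI[of _ "J - {i}"]) auto
  qed
  obtain J where J: "J \<subseteq> I" "finite J" "i \<notin> J" "card (F `` J \<union> (F `` {i} - {y})) \<le> card J"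
    using ex[OF y] by blast
  obtain K where K: "K \<subseteq> I" "finite K" "i \<notin> K" "card (F `` K \<union> (F `` {i} - {z})) \<le> card K"
    using ex[OF z] by blast
  let ?P = "F `` J \<union> (F `` {i} - {y})" and ?Q = "F `` K \<union> (F `` {i} - {z})"
  have finF: "finite (F `` L)" if "L \<subseteq> I" "finite L" for L
  proof -
    have "F `` L = (\<Union>j\<in>L. F `` {j})"
      by blast
    then show ?thesis
      using fin that by auto
  qed
  have finPQ: "finite ?P" "finite ?Q"
    using finF J K fin i by auto
  \<comment> \<open>As \<open>y \<noteq> z\<close>, the two punctured neighbourhoods of
    \<open>i\<close> cover the whole one. The extra index \<open>i\<close> pushes
    \<open>card ?P + card ?Q\<close> above \<open>card J + card K\<close>.\<close>
  have "card (insert i (J \<union> K)) \<le> card (F `` insert i (J \<union> K))"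
    using J K i by (intro hall[unfolded hall_def, rule_format]) auto
  also have "\<dots> \<le> card (?P \<union> ?Q)"
    using \<open>y \<noteq> z\<close> finPQ by (intro card_mono) auto
  finally have 1: "card (J \<union> K) + 1 \<le> card (?P \<union> ?Q)"
    using J K by simp
  have "card (J \<inter> K) \<le> card (F `` (J \<inter> K))"
    using hall J by (simp add: hall_def le_infI1)
  also have "\<dots> \<le> card (?P \<inter> ?Q)"
    using finPQ by (intro card_mono) auto
  finally have 2: "card (J \<inter> K) \<le> card (?P \<inter> ?Q)" .
  show False
    using 1 2 card_Un_Int[OF finPQ] card_Un_Int[OF J(2) K(2)] J(4) K(4) by linarith
qed

text \<open>Once no edge can be deleted, each index has at most one neighbour. Hall's condition on
  singletons gives the choice, and on pairs its injectivity.\<close>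

theorem hall_transversal:
  assumes fin: "\<And>i. i \<in> I \<Longrightarrow> finite (E `` {i})" and "hall I E"
  obtains s where "\<And>i. i \<in> I \<Longrightarrow> (i, s i) \<in> E" "inj_on s I"
proof -
  obtain F where F: "F \<subseteq> E" "hall I F" "\<And>e. e \<in> F \<Longrightarrow> \<not> hall I (F - {e})"
    using hall_maximal_removal[OF assms] by blast
  have finF: "finite (F `` {i})" if "i \<in> I" for i
    using fin[OF that] F(1) by (meson Image_mono finite_subset order_refl)
  have single: "y = z" if "i \<in> I" "(i, y) \<in> F" "(i, z) \<in> F" for i y z
    using hall_minimal_single_valued[OF finF F(2,3) that] by blast
  have card: "card J \<le> card (F `` J)" if "J \<subseteq> I" "finite J" for J
    using F(2) that by (simp add: hall_def)
  have "\<exists>y. (i, y) \<in> F" if "i \<in> I" for i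
  proof -
    have "F `` {i} \<noteq> {}"
      using card[of "{i}"] that by auto
    then show ?thesis
      by blast
  qed
  then obtain s where s: "\<And>i. i \<in> I \<Longrightarrow> (i, s i) \<in> F"
    by metis
  have "inj_on s I"
  proof (rule inj_onI, rule ccontr)
    fix i j assume ij: "i \<in> I" "j \<in> I" "s i = s j" "i \<noteq> j"
    have "F `` {i, j} \<subseteq> {s i}"
      using single[OF ij(1) _ s[OF ij(1)]] single[OF ij(2) _ s[OF ij(2)]] ij(3) by auto
    then have "card (F `` {i, j}) \<le> 1"
      using card_mono[of "{s i}"] by fastforce
    then show False
      using card[of "{i, j}"] ij by auto
  qed
  then show thesis
    using s F(1) that by blast
qed

text \<open>Hall's condition by counting: \<open>f\<close> injects the
  \<open>card J * card C\<close> points over \<open>J\<close> into the fibres over the neighbours of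
  \<open>J\<close>, each of size \<open>card C\<close>. The value \<open>m a\<close> records an edge
  of \<open>f\<close> behind the chosen neighbour.\<close>

lemma injective_selection:
  assumes C: "finite C" "C \<noteq> {}" and f: "f ` (A \<times> C) \<subseteq> B \<times> C" "inj_on f (A \<times> C)"
  obtains m where "\<And>a. a \<in> A \<Longrightarrow> m a \<in> C" "inj_on (\<lambda>a. fst (f (a, m a))) A"
proof -
  define E where "E = {(a, fst (f (a, c))) | a c. a \<in> A \<and> c \<in> C}"
  have im: "E `` J = (\<lambda>x. fst (f x)) ` (J \<times> C)" if "J \<subseteq> A" for J
    using that by (force simp: E_def)
  have "hall A E"
    unfolding hall_def
  proof (intro allI impI)
    fix J assume J: "J \<subseteq> A" "finite J"
    have "finite (E `` J)"
      using J C by (simp add: im)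
    have "card J * card C = card (J \<times> C)"
      by (simp add: card_cartesian_product)
    also have "\<dots> \<le> card (E `` J \<times> C)"
    proof (rule card_inj_on_le)
      show "inj_on f (J \<times> C)"
        using f(2) J by (meson Sigma_mono inj_on_subset order_refl)
      show "f ` (J \<times> C) \<subseteq> E `` J \<times> C"
      proof (intro subsetI, elim imageE)
        fix y x assume "y = f x" "x \<in> J \<times> C"
        moreover from this have "f x \<in> B \<times> C"
          using f(1) J by blast
        ultimately show "y \<in> E `` J \<times> C"
          by (auto simp: im[OF J(1)] mem_Times_iff)
      qed
      show "finite (E `` J \<times> C)"
        using \<open>finite (E `` J)\<close> C by simp
    qed
    also have "\<dots> = card (E `` J) * card C"
      by (simp add: card_cartesian_product)
    finally show "card J \<le> card (E `` J)"
      using C by (simp add: card_gt_0_iff)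
  qed
  moreover have "finite (E `` {a})" if "a \<in> A" for a
    using im[of "{a}"] that C by simp
  ultimately obtain s where s: "\<And>a. a \<in> A \<Longrightarrow> (a, s a) \<in> E" "inj_on s A"
    using hall_transversal by metis
  have "\<forall>a\<in>A. \<exists>c. c \<in> C \<and> s a = fst (f (a, c))"
    using s(1) by (auto simp: E_def)
  then obtain m where m: "\<forall>a\<in>A. m a \<in> C \<and> s a = fst (f (a, m a))"
    by metis
  then have "inj_on (\<lambda>a. fst (f (a, m a))) A"
    using s(2) by (simp add: inj_on_def)
  with m that show thesis
    by blast
qed

text \<open>Schroeder-Bernstein is carried out explicitly because the bijection must follow an edge
  of \<open>f\<close> at every point: one selected from the \<open>A\<close> side, or one selected
  from the \<open>B\<close> side and read backwards.\<close>

lemma bijective_selection: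
  assumes C: "finite C" "C \<noteq> {}" and f: "bij_betw f (A \<times> C) (B \<times> C)"
  obtains m where "\<And>a. a \<in> A \<Longrightarrow> m a \<in> C" "bij_betw (\<lambda>a. fst (f (a, m a))) A B"
proof -
  define g where "g = inv_into (A \<times> C) f"
  have g: "bij_betw g (B \<times> C) (A \<times> C)"
    unfolding g_def using f by (rule bij_betw_inv_into)
  have fg: "f (g y) = y" if "y \<in> B \<times> C" for y
    using f that by (simp add: g_def bij_betw_inv_into_right)
  obtain m1 where m1: "\<And>a. a \<in> A \<Longrightarrow> m1 a \<in> C" "inj_on (\<lambda>a. fst (f (a, m1 a))) A"
    using injective_selection[OF C, of f A B] f by (auto simp: bij_betw_def)
  obtain m2 where m2: "\<And>b. b \<in> B \<Longrightarrow> m2 b \<in> C" "inj_on (\<lambda>b. fst (g (b, m2 b))) B"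
    using injective_selection[OF C, of g B A] g by (auto simp: bij_betw_def)
  define i where "i = (\<lambda>a. fst (f (a, m1 a)))"
  define j where "j = (\<lambda>b. fst (g (b, m2 b)))"
  have i: "i a \<in> B" if "a \<in> A" for a
    using bij_betwE[OF f] m1(1) that by (fastforce simp: i_def mem_Times_iff)
  have gmem: "g (b, m2 b) \<in> A \<times> C" if "b \<in> B" for b
    using bij_betwE[OF g] m2(1) that by fastforce
  \<comment> \<open>The points reached by iterating \<open>j \<circ> i\<close> from the points of
    \<open>A\<close> outside the image of \<open>j\<close>. The fixed point equation says that
    \<open>j\<close> maps the complement in \<open>B\<close> of the image of \<open>S\<close> onto
    \<open>A - S\<close>.\<close>
  define S where "S = lfp (\<lambda>X. A - j ` (B - i ` X))"
  have S: "S = A - j ` (B - i ` S)"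
    unfolding S_def by (rule lfp_unfold) (intro monoI Diff_mono image_mono order_refl)
  define k where "k = inv_into B j"
  have jB: "j ` B \<subseteq> A"
    using gmem by (force simp: j_def)
  have S2: "A - S = j ` (B - i ` S)"
    using S jB by blast
  have SA: "S \<subseteq> A"
    using S by blast
  have injj: "inj_on j B"
    using m2(2) by (simp add: j_def)
  have k: "bij_betw k (A - S) (B - i ` S)"
    unfolding k_def S2
    by (rule bij_betw_inv_into_subset[OF inj_on_imp_bij_betw[OF injj]]) auto
  have jk: "j (k a) = a" if "a \<in> A - S" for a
    using that S2 by (auto simp: k_def f_inv_into_f)
  \<comment> \<open>Outside \<open>S\<close> one has \<open>a = j (k a)\<close>, so
    \<open>(a, m a)\<close> is the end of the edge of \<open>g\<close> selected at
    \<open>k a\<close>.\<close>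
  define m where "m = (\<lambda>a. if a \<in> S then m1 a else snd (g (k a, m2 (k a))))"
  have kB: "k a \<in> B" if "a \<in> A - S" for a
    using bij_betwE[OF k] that by blast
  have kf: "f (a, m a) = (k a, m2 (k a))" if "a \<in> A - S" for a
  proof -
    have "(a, m a) = g (k a, m2 (k a))"
      using jk[OF that] that by (simp add: m_def j_def prod_eq_iff)
    then show ?thesis
      using fg kB[OF that] m2(1) by simp
  qed
  show thesis
  proof (rule that[of m])
    show "m a \<in> C" if "a \<in> A" for a
      using that m1(1) gmem kB by (auto simp: m_def mem_Times_iff)
    have "bij_betw (\<lambda>a. fst (f (a, m a))) S (i ` S)"
      using m1(2) SA by (auto simp: bij_betw_def i_def m_def inj_on_def subset_iff)
    moreover have "bij_betw (\<lambda>a. fst (f (a, m a))) (A - S) (B - i ` S)"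
      by (rule bij_betw_cong[THEN iffD1, OF _ k]) (simp add: kf)
    ultimately have "bij_betw (\<lambda>a. fst (f (a, m a))) (S \<union> (A - S)) (i ` S \<union> (B - i ` S))"
      by (rule bij_betw_combine) blast
    moreover have "S \<union> (A - S) = A" "i ` S \<union> (B - i ` S) = B"
      using SA i by blast+
    ultimately show "bij_betw (\<lambda>a. fst (f (a, m a))) A B"
      by simp
  qed
qed

section \<open>Cancelling with trivial symmetry group\<close>

text \<open>Substitute \<open>g x\<close> for \<open>x\<close>. This clears the inverses from both
  twisting conditions and leaves intertwining equations.\<close>

lemma ball_inv_into_iff:
  assumes "bij_betw g X X"
  shows "(\<forall>x\<in>X. P (inv_into X g x) x) \<longleftrightarrow> (\<forall>x\<in>X. P x (g x))"
  using bij_betwE[OF assms] bij_betwE[OF bij_betw_inv_into[OF assms]]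
    bij_betw_inv_into_left[OF assms] bij_betw_inv_into_right[OF assms]
  by metis

lemma twist_prod_fixed_iff:
  assumes "bij_betw \<alpha> A A" "bij_betw \<gamma> C C"
  shows "(\<forall>x\<in>A \<times> C. twist_prod A C \<alpha> \<beta> \<gamma> f x = f x) \<longleftrightarrow>
    (\<forall>a\<in>A. \<forall>c\<in>C. f (\<alpha> a, \<gamma> c) = map_prod \<beta> \<gamma> (f (a, c)))"
proof -
  have "(\<forall>x\<in>A \<times> C. twist_prod A C \<alpha> \<beta> \<gamma> f x = f x) \<longleftrightarrow>
    (\<forall>a\<in>A. \<forall>c\<in>C. f (a, c) = map_prod \<beta> \<gamma> (f (inv_into A \<alpha> a, inv_into C \<gamma> c)))"
    by (auto simp: twist_prod_def)
  also have "\<dots> \<longleftrightarrow> (\<forall>a\<in>A. \<forall>c\<in>C. f (\<alpha> a, c) = map_prod \<beta> \<gamma> (f (a, inv_into C \<gamma> c)))"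
    by (rule ball_inv_into_iff[OF assms(1),
          of "\<lambda>a' a. \<forall>c\<in>C. f (a, c) = map_prod \<beta> \<gamma> (f (a', inv_into C \<gamma> c))"])
  also have "\<dots> \<longleftrightarrow> (\<forall>a\<in>A. \<forall>c\<in>C. f (\<alpha> a, \<gamma> c) = map_prod \<beta> \<gamma> (f (a, c)))"
    by (rule ball_cong[OF refl], rule ball_inv_into_iff[OF assms(2)])
  finally show ?thesis .
qed

lemma twist_fixed_iff:
  assumes "bij_betw \<alpha> A A"
  shows "(\<forall>a\<in>A. twist A \<alpha> \<beta> h a = h a) \<longleftrightarrow> (\<forall>a\<in>A. h (\<alpha> a) = \<beta> (h a))"
  using ball_inv_into_iff[OF assms, of "\<lambda>a' a. \<beta> (h a') = h a"] by (auto simp: twist_def)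

lemma equivariant_quotient_iff:
  assumes "\<Gamma> \<subseteq> Bij C"
  shows "equivariant_quotient A B C \<Gamma> f h \<longleftrightarrow>
    bij_betw h A B \<and>
    (\<forall>\<alpha>\<in>Bij A. \<forall>\<beta>\<in>Bij B. \<forall>\<gamma>\<in>\<Gamma>.
      (\<forall>a\<in>A. \<forall>c\<in>C. f (\<alpha> a, \<gamma> c) = map_prod \<beta> \<gamma> (f (a, c))) \<longrightarrow>
      (\<forall>a\<in>A. h (\<alpha> a) = \<beta> (h a)))"
proof -
  have "(\<forall>x\<in>A \<times> C. twist_prod A C \<alpha> \<beta> \<gamma> f x = f x) \<longleftrightarrow>
      (\<forall>a\<in>A. \<forall>c\<in>C. f (\<alpha> a, \<gamma> c) = map_prod \<beta> \<gamma> (f (a, c)))"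
    "(\<forall>a\<in>A. twist A \<alpha> \<beta> h a = h a) \<longleftrightarrow> (\<forall>a\<in>A. h (\<alpha> a) = \<beta> (h a))"
    if "\<alpha> \<in> Bij A" "\<gamma> \<in> \<Gamma>" for \<alpha> \<beta> \<gamma>
  proof -
    have "bij_betw \<alpha> A A" "bij_betw \<gamma> C C"
      using that assms by (auto simp: Bij_def)
    then show "(\<forall>x\<in>A \<times> C. twist_prod A C \<alpha> \<beta> \<gamma> f x = f x) \<longleftrightarrow>
        (\<forall>a\<in>A. \<forall>c\<in>C. f (\<alpha> a, \<gamma> c) = map_prod \<beta> \<gamma> (f (a, c)))"
      "(\<forall>a\<in>A. twist A \<alpha> \<beta> h a = h a) \<longleftrightarrow> (\<forall>a\<in>A. h (\<alpha> a) = \<beta> (h a))"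
      by (simp_all only: twist_prod_fixed_iff twist_fixed_iff)
  qed
  then show ?thesis
    unfolding equivariant_quotient_def by (simp cong: ball_cong)
qed

text \<open>With \<open>bij_betw\<close> in place of \<open>Bij\<close>, values off \<open>A\<close>
  and \<open>B\<close> are free, and the pairs are closed under plain \<open>id\<close> and
  \<open>\<circ>\<close>.\<close>

definition automorphisms ::
  "'a set \<Rightarrow> 'b set \<Rightarrow> 'c set \<Rightarrow> ('a \<times> 'c \<Rightarrow> 'b \<times> 'c) \<Rightarrow> (('a \<Rightarrow> 'a) \<times> ('b \<Rightarrow> 'b)) set"
  where "automorphisms A B C f = {(\<alpha>, \<beta>). bij_betw \<alpha> A A \<and> bij_betw \<beta> B B \<and>
    (\<forall>a\<in>A. \<forall>c\<in>C. f (\<alpha> a, c) = map_prod \<beta> id (f (a, c)))}"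

lemma automorphisms_id: "(id, id) \<in> automorphisms A B C f"
  by (simp add: automorphisms_def map_prod.id)

lemma automorphisms_comp:
  assumes "(\<alpha>, \<beta>) \<in> automorphisms A B C f" "(\<alpha>', \<beta>') \<in> automorphisms A B C f"
  shows "(\<alpha> \<circ> \<alpha>', \<beta> \<circ> \<beta>') \<in> automorphisms A B C f"
proof -
  have "bij_betw (\<alpha> \<circ> \<alpha>') A A" "bij_betw (\<beta> \<circ> \<beta>') B B"
    using assms by (auto simp: automorphisms_def intro: bij_betw_trans)
  moreover have "\<alpha>' a \<in> A" if "a \<in> A" for a
    using assms that by (auto simp: automorphisms_def dest: bij_betwE)
  ultimately show ?thesis
    using assms by (simp add: automorphisms_def map_prod.comp[symmetric] map_prod_def split_beta)
qed

lemma automorphisms_inv: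
  assumes f: "f ` (A \<times> C) \<subseteq> B \<times> C" and aut: "(\<alpha>, \<beta>) \<in> automorphisms A B C f"
  shows "(inv_into A \<alpha>, inv_into B \<beta>) \<in> automorphisms A B C f"
proof -
  have bij: "bij_betw \<alpha> A A" "bij_betw \<beta> B B"
    and eq: "\<And>a c. a \<in> A \<Longrightarrow> c \<in> C \<Longrightarrow> f (\<alpha> a, c) = map_prod \<beta> id (f (a, c))"
    using aut by (auto simp: automorphisms_def)
  have "f (inv_into A \<alpha> a, c) = map_prod (inv_into B \<beta>) id (f (a, c))" if ac: "a \<in> A" "c \<in> C" for a c
  proof -
    let ?a = "inv_into A \<alpha> a"
    have a: "?a \<in> A" "\<alpha> ?a = a"
      using ac bij bij_betwE[OF bij_betw_inv_into[OF bij(1)]] by (auto simp: bij_betw_inv_into_right)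
    then have "f (?a, c) \<in> B \<times> C"
      using f ac by blast
    moreover have "f (a, c) = map_prod \<beta> id (f (?a, c))"
      using eq[OF a(1) ac(2)] a by simp
    ultimately show ?thesis
      using bij by (cases "f (?a, c)") (auto simp: bij_betw_inv_into_left)
  qed
  then show ?thesis
    using bij by (simp add: automorphisms_def bij_betw_inv_into)
qed

text \<open>\<open>SOME\<close> is applied to membership in the orbit of \<open>x\<close>, a
  predicate that is the same at all points of one orbit.\<close>

lemma orbit_representatives:
  assumes id: "id \<in> G" and comp: "\<And>g h. g \<in> G \<Longrightarrow> h \<in> G \<Longrightarrow> g \<circ> h \<in> G"
    and inv: "\<And>g. g \<in> G \<Longrightarrow> bij_betw g X X \<and> inv_into X g \<in> G"
  obtains r where "\<And>x. x \<in> X \<Longrightarrow> \<exists>g\<in>G. r x = g x"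
    "\<And>x g. x \<in> X \<Longrightarrow> g \<in> G \<Longrightarrow> r (g x) = r x"
proof -
  define r where "r = (\<lambda>x. SOME y. \<exists>g\<in>G. y = g x)"
  show thesis
  proof (rule that[of r])
    show "\<exists>g\<in>G. r x = g x" for x
      unfolding r_def using id by (intro someI_ex[of "\<lambda>y. \<exists>g\<in>G. y = g x"]) blast
    fix x g assume x: "x \<in> X" and g: "g \<in> G"
    have "(\<exists>h\<in>G. y = h (g x)) \<longleftrightarrow> (\<exists>h\<in>G. y = h x)" for y
    proof
      assume "\<exists>h\<in>G. y = h (g x)"
      then show "\<exists>h\<in>G. y = h x"
        using comp g by (metis comp_apply)
    next
      assume "\<exists>h\<in>G. y = h x"
      then obtain h where h: "h \<in> G" "y = h x"
        by blast
      moreover have "inv_into X g (g x) = x"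
        using inv[OF g] x by (metis bij_betw_inv_into_left)
      ultimately have "y = (h \<circ> inv_into X g) (g x)"
        by simp
      then show "\<exists>h\<in>G. y = h (g x)"
        using comp[OF h(1)] inv[OF g] by blast
    qed
    then show "r (g x) = r x"
      by (simp add: r_def)
  qed
qed

text \<open>The label chosen at \<open>a\<close> depends only on the orbit of \<open>a\<close>, and
  automorphisms leave \<open>C\<close>-coordinates alone, so equivariance is automatic. Bijectivity
  is lifted from the representatives.\<close>

lemma automorphism_invariant_bijection:
  assumes C: "finite C" "C \<noteq> {}" and f: "bij_betw f (A \<times> C) (B \<times> C)"
  obtains h where "bij_betw h A B"
    "\<And>\<alpha> \<beta> a. (\<alpha>, \<beta>) \<in> automorphisms A B C f \<Longrightarrow> a \<in> A \<Longrightarrow> h (\<alpha> a) = \<beta> (h a)"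
proof -
  let ?Aut = "automorphisms A B C f"
  have bij: "bij_betw \<alpha> A A" "bij_betw \<beta> B B" if "(\<alpha>, \<beta>) \<in> ?Aut" for \<alpha> \<beta>
    using that by (auto simp: automorphisms_def)
  have fmem: "f (a, c) \<in> B \<times> C" if "a \<in> A" "c \<in> C" for a c
    using bij_betwE[OF f] that by blast
  have f_Aut: "f (\<alpha> a, c) = (\<beta> (fst (f (a, c))), snd (f (a, c)))"
    if "(\<alpha>, \<beta>) \<in> ?Aut" "a \<in> A" "c \<in> C" for \<alpha> \<beta> a c
    using that by (simp add: automorphisms_def map_prod_def split_beta)
  have f_inj: "a = a' \<and> c = c'" if "f (a, c) = f (a', c')" "a \<in> A" "a' \<in> A" "c \<in> C" "c' \<in> C" for a a' c c'
    using inj_onD[OF bij_betw_imp_inj_on[OF f] that(1)] that by simp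
  have sub: "f ` (A \<times> C) \<subseteq> B \<times> C"
    using f by (simp add: bij_betw_def)
  have fst_Aut: "g \<in> fst ` ?Aut \<longleftrightarrow> (\<exists>\<beta>. (g, \<beta>) \<in> ?Aut)" for g
    by force
  have snd_Aut: "g \<in> snd ` ?Aut \<longleftrightarrow> (\<exists>\<alpha>. (\<alpha>, g) \<in> ?Aut)" for g
    by force
  obtain r where r: "\<And>a. a \<in> A \<Longrightarrow> \<exists>g\<in>fst ` ?Aut. r a = g a"
    "\<And>a g. a \<in> A \<Longrightarrow> g \<in> fst ` ?Aut \<Longrightarrow> r (g a) = r a"
  proof (rule orbit_representatives[of "fst ` ?Aut" A])
    show "id \<in> fst ` ?Aut"
      using automorphisms_id unfolding fst_Aut by blast
    show "g \<circ> h \<in> fst ` ?Aut" if "g \<in> fst ` ?Aut" "h \<in> fst ` ?Aut" for g h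
      using that automorphisms_comp unfolding fst_Aut by blast
    show "bij_betw g A A \<and> inv_into A g \<in> fst ` ?Aut" if "g \<in> fst ` ?Aut" for g
      using that bij automorphisms_inv[OF sub] unfolding fst_Aut by blast
  qed blast
  obtain q where q: "\<And>b. b \<in> B \<Longrightarrow> \<exists>g\<in>snd ` ?Aut. q b = g b"
    "\<And>b g. b \<in> B \<Longrightarrow> g \<in> snd ` ?Aut \<Longrightarrow> q (g b) = q b"
  proof (rule orbit_representatives[of "snd ` ?Aut" B])
    show "id \<in> snd ` ?Aut"
      using automorphisms_id unfolding snd_Aut by blast
    show "g \<circ> h \<in> snd ` ?Aut" if "g \<in> snd ` ?Aut" "h \<in> snd ` ?Aut" for g h
      using that automorphisms_comp unfolding snd_Aut by blast
    show "bij_betw g B B \<and> inv_into B g \<in> snd ` ?Aut" if "g \<in> snd ` ?Aut" for g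
      using that bij automorphisms_inv[OF sub] unfolding snd_Aut by blast
  qed blast
  have r_Aut: "r (\<alpha> a) = r a" if "(\<alpha>, \<beta>) \<in> ?Aut" "a \<in> A" for \<alpha> \<beta> a
    using r(2) that unfolding fst_Aut by blast
  have q_Aut: "q (\<beta> b) = q b" if "(\<alpha>, \<beta>) \<in> ?Aut" "b \<in> B" for \<alpha> \<beta> b
    using q(2) that unfolding snd_Aut by blast
  have r_ex: "\<exists>\<alpha> \<beta>. (\<alpha>, \<beta>) \<in> ?Aut \<and> r a = \<alpha> a" if "a \<in> A" for a
    using r(1)[OF that] fst_Aut by metis
  have q_ex: "\<exists>\<alpha> \<beta>. (\<alpha>, \<beta>) \<in> ?Aut \<and> q b = \<beta> b" if "b \<in> B" for b
    using q(1)[OF that] snd_Aut by metis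
  have r_mem: "r a \<in> A" "r (r a) = r a" if "a \<in> A" for a
    using r_ex[OF that] r_Aut that bij by (metis bij_betwE)+
  \<comment> \<open>Points with one representative differ by an automorphism. The whole pair is
    produced because its first component will act on \<open>A\<close>.\<close>
  have q_eq: "\<exists>\<alpha> \<beta>. (\<alpha>, \<beta>) \<in> ?Aut \<and> b' = \<beta> b" if b: "b \<in> B" "b' \<in> B" "q b = q b'" for b b'
  proof -
    obtain \<alpha> \<beta> \<alpha>' \<beta>' where *: "(\<alpha>, \<beta>) \<in> ?Aut" "q b = \<beta> b" "(\<alpha>', \<beta>') \<in> ?Aut" "q b' = \<beta>' b'"
      using q_ex b by meson
    have "b' = inv_into B \<beta>' (\<beta> b)"
      using * b bij by (metis bij_betw_inv_into_left)
    then show ?thesis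
      using automorphisms_comp[OF automorphisms_inv[OF sub *(3)] *(1)]
      by (intro exI[of _ "inv_into A \<alpha>' \<circ> \<alpha>"] exI[of _ "inv_into B \<beta>' \<circ> \<beta>"]) simp
  qed
  \<comment> \<open>This is \<open>f\<close> with points of \<open>B\<close> replaced by orbit
    representatives; by \<open>F_r\<close> it depends on \<open>a\<close> only through its
    orbit.\<close>
  define F where "F = (\<lambda>x. (q (fst (f x)), snd (f x)))"
  have F_r: "F (r a, c) = F (a, c)" if "a \<in> A" "c \<in> C" for a c
    using r_ex[OF that(1)] f_Aut q_Aut fmem[OF that] that by (fastforce simp: F_def mem_Times_iff)
  have "bij_betw F (r ` A \<times> C) (q ` B \<times> C)"
    unfolding bij_betw_def
  proof
    show "inj_on F (r ` A \<times> C)"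
    proof (rule inj_onI, clarify)
      fix a c a' c' assume a: "a \<in> A" "a' \<in> A" and c: "c \<in> C" "c' \<in> C"
        and eq: "F (r a, c) = F (r a', c')"
      then have eq: "F (a, c) = F (a', c')"
        by (simp add: F_r)
      \<comment> \<open>Moving \<open>a\<close> by an automorphism makes the values of
        \<open>f\<close> equal, not only their orbits, so injectivity of \<open>f\<close>
        applies.\<close>
      then obtain \<alpha> \<beta> where *: "(\<alpha>, \<beta>) \<in> ?Aut" "fst (f (a', c')) = \<beta> (fst (f (a, c)))"
        using q_eq[of "fst (f (a, c))" "fst (f (a', c'))"] fmem[OF a(1) c(1)] fmem[OF a(2) c(2)]
        by (auto simp: F_def mem_Times_iff)
      then have "f (\<alpha> a, c) = f (a', c')"
        using f_Aut[OF *(1) a(1) c(1)] eq by (simp add: F_def prod_eq_iff)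
      moreover have "\<alpha> a \<in> A"
        using bij[OF *(1)] a by (auto dest: bij_betwE)
      ultimately have "\<alpha> a = a' \<and> c = c'"
        using f_inj a c by blast
      then show "r a = r a' \<and> c = c'"
        using r_Aut[OF *(1) a(1)] by simp
    qed
    show "F ` (r ` A \<times> C) = q ` B \<times> C"
    proof (intro equalityI subsetI)
      fix y assume "y \<in> F ` (r ` A \<times> C)"
      then show "y \<in> q ` B \<times> C"
        using F_r fmem by (auto simp: F_def mem_Times_iff)
    next
      fix y assume "y \<in> q ` B \<times> C"
      then obtain b d where y: "b \<in> B" "d \<in> C" "y = (q b, d)"
        by blast
      then obtain a c where ac: "a \<in> A" "c \<in> C" "(b, d) = f (a, c)"
        using bij_betw_imp_surj_on[OF f] by (metis (no_types, lifting) SigmaE SigmaI imageE)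
      then have "F (r a, c) = y"
        using F_r[OF ac(1,2)] y by (simp add: F_def flip: ac(3))
      then show "y \<in> F ` (r ` A \<times> C)"
        using ac by blast
    qed
  qed
  then obtain m where m: "\<And>x. x \<in> r ` A \<Longrightarrow> m x \<in> C"
    and k: "bij_betw (\<lambda>x. fst (F (x, m x))) (r ` A) (q ` B)"
    using bijective_selection[OF C] by metis
  define h where "h = (\<lambda>a. fst (f (a, m (r a))))"
  have mC: "m (r a) \<in> C" if "a \<in> A" for a
    using m that by blast
  have hB: "h a \<in> B" if "a \<in> A" for a
    using fmem[OF that mC[OF that]] by (auto simp: h_def mem_Times_iff)
  have qh: "q (h a) = fst (F (r a, m (r a)))" if "a \<in> A" for a
    using F_r[OF that mC[OF that]] by (simp add: F_def h_def)
  have h_Aut: "h (\<alpha> a) = \<beta> (h a)" if "(\<alpha>, \<beta>) \<in> ?Aut" "a \<in> A" for \<alpha> \<beta> a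
    using f_Aut[OF that mC[OF that(2)]] r_Aut[OF that] by (simp add: h_def)
  have "bij_betw h A B"
    unfolding bij_betw_def
  proof
    show "inj_on h A"
    proof (rule inj_onI)
      fix a a' assume a: "a \<in> A" "a' \<in> A" and eq: "h a = h a'"
      then have "r a = r a'"
        using qh inj_onD[OF bij_betw_imp_inj_on[OF k]] by (metis (no_types, lifting) imageI)
      then have "F (a, m (r a)) = F (a', m (r a))"
        using F_r a mC by metis
      then have "f (a, m (r a)) = f (a', m (r a))"
        using eq \<open>r a = r a'\<close> by (simp add: F_def h_def prod_eq_iff)
      then show "a = a'"
        using f_inj a mC by blast
    qed
    show "h ` A = B"
    proof (intro equalityI subsetI)
      fix b assume b: "b \<in> B"
      then have "q b \<in> (\<lambda>x. fst (F (x, m x))) ` r ` A"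
        using bij_betw_imp_surj_on[OF k] by blast
      then obtain a where a: "a \<in> A" "q b = fst (F (r a, m (r a)))"
        by blast
      then have "q (h a) = q b"
        using qh by simp
      then obtain \<alpha> \<beta> where *: "(\<alpha>, \<beta>) \<in> ?Aut" "b = \<beta> (h a)"
        using q_eq[OF hB[OF a(1)] b] by blast
      then have "b = h (\<alpha> a)"
        using h_Aut a by simp
      then show "b \<in> h ` A"
        using bij(1)[OF *(1)] a by (auto dest: bij_betwE)
    qed (use hB in auto)
  qed
  with h_Aut that show thesis
    by blast
qed

lemma fully_cancelling_trivial:
  assumes "finite C" "C \<noteq> {}"
  shows "fully_cancelling TYPE('a) TYPE('b) C {\<lambda>x\<in>C. x}"
  unfolding fully_cancelling_def
proof (intro allI impI)
  fix A :: "'a set" and B :: "'b set" and f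
  assume f: "bij_betw f (A \<times> C) (B \<times> C)"
  obtain h where h: "bij_betw h A B"
    "\<And>\<alpha> \<beta> a. (\<alpha>, \<beta>) \<in> automorphisms A B C f \<Longrightarrow> a \<in> A \<Longrightarrow> h (\<alpha> a) = \<beta> (h a)"
    using automorphism_invariant_bijection[OF assms f] by blast
  have "(\<alpha>, \<beta>) \<in> automorphisms A B C f"
    if "\<alpha> \<in> Bij A" "\<beta> \<in> Bij B"
      and eq: "\<forall>a\<in>A. \<forall>c\<in>C. f (\<alpha> a, (\<lambda>x\<in>C. x) c) = map_prod \<beta> (\<lambda>x\<in>C. x) (f (a, c))" for \<alpha> \<beta>
  proof -
    \<comment> \<open>The restricted identity acts as \<open>id\<close> here because
      \<open>c\<close> and the second coordinate of \<open>f (a, c)\<close> lie in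
      \<open>C\<close>.\<close>
    have "f (\<alpha> a, c) = map_prod \<beta> id (f (a, c))" if "a \<in> A" "c \<in> C" for a c
    proof -
      have "f (a, c) \<in> B \<times> C"
        using bij_betwE[OF f] that by blast
      then show ?thesis
        using eq that by (cases "f (a, c)") auto
    qed
    then show ?thesis
      using that by (auto simp: automorphisms_def Bij_def)
  qed
  then have "equivariant_quotient A B C {\<lambda>x\<in>C. x} f h"
    using h by (subst equivariant_quotient_iff) (auto simp: id_Bij)
  then show "\<exists>h. equivariant_quotient A B C {\<lambda>x\<in>C. x} f h"
    by blast
qed

section \<open>Nontrivial symmetry groups\<close>

text \<open>The triple of \<open>\<alpha>\<close>, the identity and \<open>\<gamma>\<close> fixes
  \<open>f\<close>, so a quotient would take equal values at \<open>x0\<close> and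
  \<open>\<alpha> x0\<close>, against injectivity. The maps \<open>\<sigma>\<close> and
  \<open>\<tau>\<close> carry the example into the given universes.\<close>

lemma not_fully_cancellingI:
  fixes \<sigma> :: "'x \<Rightarrow> 'a" and \<tau> :: "'y \<Rightarrow> 'b"
  assumes \<Gamma>: "\<Gamma> \<subseteq> Bij C" "\<gamma> \<in> \<Gamma>"
    and f: "bij_betw f (X \<times> C) (Y \<times> C)" and \<alpha>: "bij_betw \<alpha> X X"
    and eq: "\<And>x c. x \<in> X \<Longrightarrow> c \<in> C \<Longrightarrow> f (\<alpha> x, \<gamma> c) = map_prod id \<gamma> (f (x, c))"
    and x0: "x0 \<in> X" "\<alpha> x0 \<noteq> x0"
    and inj: "inj_on \<sigma> X" "inj_on \<tau> Y"
  shows "\<not> fully_cancelling TYPE('a) TYPE('b) C \<Gamma>"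
proof
  assume fc: "fully_cancelling TYPE('a) TYPE('b) C \<Gamma>"
  let ?A = "\<sigma> ` X" and ?B = "\<tau> ` Y"
  define s where "s = inv_into X \<sigma>"
  have s: "s (\<sigma> x) = x" if "x \<in> X" for x
    using inj that by (simp add: s_def)
  have bij_s: "bij_betw s ?A X" and bij_\<sigma>: "bij_betw \<sigma> X ?A"
    using inj by (auto simp: s_def inj_on_imp_bij_betw intro: bij_betw_inv_into)
  have \<alpha>X: "\<alpha> x \<in> X" if "x \<in> X" for x
    using \<alpha> that by (auto dest: bij_betwE)
  define g where "g = map_prod \<tau> id \<circ> (f \<circ> map_prod s (id :: 'c \<Rightarrow> 'c))"
  have "bij_betw g (?A \<times> C) (?B \<times> C)"
    unfolding g_def
    by (intro bij_betw_trans[OF bij_betw_trans[OF _ f]] bij_betw_map_prod bij_s bij_betw_id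
        inj_on_imp_bij_betw inj)
  then obtain h where h: "equivariant_quotient ?A ?B C \<Gamma> g h"
    using fc unfolding fully_cancelling_def by blast
  \<comment> \<open>The conjugate of \<open>\<alpha>\<close> by \<open>\<sigma>\<close>, restricted
    because elements of \<open>Bij\<close> are \<open>undefined\<close> off their set.\<close>
  define \<alpha>' where "\<alpha>' = (\<lambda>a\<in>?A. \<sigma> (\<alpha> (s a)))"
  have "bij_betw (\<sigma> \<circ> (\<alpha> \<circ> s)) ?A ?A"
    by (intro bij_betw_trans[OF bij_betw_trans[OF bij_s \<alpha>] bij_\<sigma>])
  then have \<alpha>': "\<alpha>' \<in> Bij ?A"
    by (simp add: Bij_def \<alpha>'_def o_def)
  have "g (\<alpha>' a, \<gamma> c) = map_prod (\<lambda>b\<in>?B. b) \<gamma> (g (a, c))" if ac: "a \<in> ?A" "c \<in> C" for a c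
  proof -
    obtain x where x: "x \<in> X" "a = \<sigma> x"
      using ac by blast
    have "f (x, c) \<in> Y \<times> C"
      using bij_betwE[OF f] x ac by blast
    then show ?thesis
      using x ac eq[OF x(1) ac(2)] by (cases "f (x, c)") (auto simp: g_def \<alpha>'_def s \<alpha>X)
  qed
  then have "h (\<alpha>' a) = (\<lambda>b\<in>?B. b) (h a)" if "a \<in> ?A" for a
    using h \<alpha>' \<Gamma> id_Bij that unfolding equivariant_quotient_iff[OF \<Gamma>(1)] by blast
  moreover have bij_h: "bij_betw h ?A ?B"
    using h by (simp add: equivariant_quotient_def)
  ultimately have "h (\<alpha>' (\<sigma> x0)) = h (\<sigma> x0)"
    using x0 by (auto dest: bij_betwE)
  moreover have "\<alpha>' (\<sigma> x0) \<in> ?A"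
    using Bij_imp_funcset[OF \<alpha>'] x0 by blast
  ultimately have "\<alpha>' (\<sigma> x0) = \<sigma> x0"
    using inj_onD[OF bij_betw_imp_inj_on[OF bij_h]] x0 by blast
  then show False
    using x0 s \<alpha>X by (auto simp: \<alpha>'_def dest: inj_onD[OF inj(1)])
qed

text \<open>An element of the group fixing as many points as possible without being trivial acts freely
  on the orbit of any point that it moves: a power fixing such a point has more fixed points.\<close>
lemma exists_free_orbit:
  assumes \<Gamma>: "subgroup \<Gamma> (BijGroup C)" and "finite C" and nontriv: "\<Gamma> \<noteq> {\<lambda>x\<in>C. x}"
  obtains \<gamma> c0 where "\<gamma> \<in> \<Gamma>" "c0 \<in> C" "\<gamma> c0 \<noteq> c0"
    "\<And>k x. (\<gamma> ^^ k) c0 = c0 \<Longrightarrow> x \<in> C \<Longrightarrow> (\<gamma> ^^ k) x = x"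
proof -
  have sub: "\<Gamma> \<subseteq> Bij C"
    using subgroup.subset[OF \<Gamma>] by (simp add: BijGroup_def)
  have one: "(\<lambda>x\<in>C. x) \<in> \<Gamma>"
    using subgroup.one_closed[OF \<Gamma>] by (simp add: BijGroup_def)
  have comp: "compose C g h \<in> \<Gamma>" if "g \<in> \<Gamma>" "h \<in> \<Gamma>" for g h
    using subgroup.m_closed[OF \<Gamma> that] that sub by (auto simp: BijGroup_def subset_iff)
  have C: "(g ^^ k) x \<in> C" if "g \<in> \<Gamma>" "x \<in> C" for g k x
    using that sub by (induction k) (auto dest: Bij_imp_funcset)
  have pow: "(\<lambda>x\<in>C. (g ^^ k) x) \<in> \<Gamma>" if "g \<in> \<Gamma>" for g k
  proof (induction k)
    case 0
    then show ?case
      using one by (simp add: restrict_def)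
  next
    case (Suc k)
    have *: "compose C g (\<lambda>x\<in>C. (g ^^ k) x) = (\<lambda>x\<in>C. (g ^^ Suc k) x)"
      by (auto simp: compose_def fun_eq_iff)
    show ?case
      using comp[OF that Suc] unfolding * .
  qed
  define moved where "moved = (\<lambda>g. {x \<in> C. g x \<noteq> x})"
  have nt: "g = (\<lambda>x\<in>C. x)" if "g \<in> \<Gamma>" "moved g = {}" for g
    using that sub by (intro extensionalityI[of _ C]) (auto simp: moved_def Bij_def)
  obtain \<gamma>1 where "\<gamma>1 \<in> \<Gamma>" "\<gamma>1 \<noteq> (\<lambda>x\<in>C. x)"
    using nontriv one by blast
  then obtain \<gamma> where \<gamma>: "\<gamma> \<in> \<Gamma>" "moved \<gamma> \<noteq> {}"
    and min: "\<And>g. g \<in> \<Gamma> \<Longrightarrow> moved g \<noteq> {} \<Longrightarrow> card (moved \<gamma>) \<le> card (moved g)"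
    using ex_has_least_nat[of "\<lambda>g. g \<in> \<Gamma> \<and> moved g \<noteq> {}" \<gamma>1 "\<lambda>g. card (moved g)"] nt by blast
  then obtain c0 where c0: "c0 \<in> C" "\<gamma> c0 \<noteq> c0"
    by (auto simp: moved_def)
  show thesis
  proof (rule that[OF \<gamma>(1) c0])
    fix k x assume k: "(\<gamma> ^^ k) c0 = c0" and x: "x \<in> C"
    let ?g = "\<lambda>x\<in>C. (\<gamma> ^^ k) x"
    have "(\<gamma> ^^ k) y = y" if "\<gamma> y = y" for y
      using that by (induction k) auto
    then have "moved ?g \<subset> moved \<gamma>"
      using k c0 by (auto simp: moved_def)
    then have "card (moved ?g) < card (moved \<gamma>)"
      using \<open>finite C\<close> by (intro psubset_card_mono) (simp_all add: moved_def)
    then have "moved ?g = {}"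
      using min[OF pow[OF \<gamma>(1)]] by (meson leD)
    then show "(\<gamma> ^^ k) x = x"
      using x by (auto simp: moved_def)
  qed
qed

text \<open>With \<open>Q\<close> a free orbit and \<open>n = card C\<close>, the set \<open>Q \<times> C\<close> with the diagonal action consists of
  \<open>n\<close> copies of \<open>Q\<close>, so it can be inserted into \<open>\<nat> \<times> C\<close> by shifting the copies of \<open>Q\<close> there.\<close>
lemma twisted_shift:
  fixes \<gamma> :: "'c \<Rightarrow> 'c"
  assumes "finite C" and \<gamma>: "bij_betw \<gamma> C C" and c0: "c0 \<in> C"
    and free: "\<And>k x. (\<gamma> ^^ k) c0 = c0 \<Longrightarrow> x \<in> C \<Longrightarrow> (\<gamma> ^^ k) x = x"
  obtains f :: "(nat + 'c) \<times> 'c \<Rightarrow> nat \<times> 'c" and Q \<alpha>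
  where "c0 \<in> Q" "Q \<subseteq> C" "bij_betw f ((UNIV <+> Q) \<times> C) (UNIV \<times> C)"
    "bij_betw \<alpha> (UNIV <+> Q) (UNIV <+> Q)" "\<alpha> (Inr c0) = Inr (\<gamma> c0)"
    "\<And>x c. x \<in> UNIV <+> Q \<Longrightarrow> c \<in> C \<Longrightarrow> f (\<alpha> x, \<gamma> c) = map_prod id \<gamma> (f (x, c))"
proof -
  define Q where "Q = range (\<lambda>k. (\<gamma> ^^ k) c0)"
  have bij_pow: "bij_betw (\<gamma> ^^ k) C C" for k
    using \<gamma> by (rule bij_betw_funpow)
  have powC: "(\<gamma> ^^ k) x \<in> C" if "x \<in> C" for k x
    using bij_betwE[OF bij_pow] that by blast
  have \<gamma>C: "\<gamma> x \<in> C" if "x \<in> C" for x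
    using \<gamma> that by (auto dest: bij_betwE)
  have QC: "Q \<subseteq> C"
    using powC c0 by (auto simp: Q_def)
  have c0Q: "c0 \<in> Q"
    unfolding Q_def by (rule range_eqI[of _ _ 0]) simp
  have \<gamma>Q: "\<gamma> y \<in> Q" if "y \<in> Q" for y
    using that by (auto simp: Q_def intro: range_eqI[of _ _ "Suc _"])
  have "\<gamma> ` Q = Q"
    using \<gamma> QC \<gamma>Q \<open>finite C\<close>
    by (intro endo_inj_surj) (auto intro: finite_subset inj_on_subset simp: bij_betw_def)
  have \<gamma>Q_iff: "\<gamma> x \<in> Q \<longleftrightarrow> x \<in> Q" if "x \<in> C" for x
  proof
    assume "\<gamma> x \<in> Q"
    then obtain y where "y \<in> Q" "\<gamma> x = \<gamma> y"
      using \<open>\<gamma> ` Q = Q\<close> by blast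
    then show "x \<in> Q"
      using \<gamma> that QC by (metis bij_betw_imp_inj_on inj_onD subsetD)
  qed (rule \<gamma>Q)
  \<comment> \<open>Freeness in usable form: cancelling the smaller power shows that powers agreeing
    at \<open>c0\<close> agree on all of \<open>C\<close>.\<close>
  have eq_le: "(\<gamma> ^^ j) x = (\<gamma> ^^ i) x"
    if "(\<gamma> ^^ i) c0 = (\<gamma> ^^ j) c0" "x \<in> C" "i \<le> j" for i j x
  proof -
    have j: "(\<gamma> ^^ j) y = (\<gamma> ^^ i) ((\<gamma> ^^ (j - i)) y)" for y
      using \<open>i \<le> j\<close> by (metis comp_apply funpow_add le_add_diff_inverse)
    have "(\<gamma> ^^ (j - i)) c0 = c0"
      using inj_onD[OF bij_betw_imp_inj_on[OF bij_pow, of i]] that(1) j[of c0] c0 powC by metis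
    then show ?thesis
      using free that(2) by (simp add: j)
  qed
  have eq: "(\<gamma> ^^ i) x = (\<gamma> ^^ j) x" if "(\<gamma> ^^ i) c0 = (\<gamma> ^^ j) c0" "x \<in> C" for i j x
    using eq_le[of i j x] eq_le[of j i x] that by (cases "i \<le> j") auto
  \<comment> \<open>For \<open>y \<in> Q\<close> this is a power of \<open>\<gamma>\<close> taking
    \<open>c0\<close> to \<open>y\<close>. By freeness the choice of exponent does not matter on
    \<open>C\<close>.\<close>
  define u where "u = (\<lambda>y. \<gamma> ^^ (SOME k. (\<gamma> ^^ k) c0 = y))"
  have u_c0: "u y c0 = y" if "y \<in> Q" for y
    using that unfolding u_def Q_def by (auto intro: someI)
  have bij_u: "bij_betw (u y) C C" for y
    unfolding u_def by (rule bij_pow)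
  have u_\<gamma>: "u (\<gamma> y) x = \<gamma> (u y x)" if "y \<in> Q" "x \<in> C" for y x
  proof -
    obtain i j where ij: "u (\<gamma> y) = \<gamma> ^^ i" "u y = \<gamma> ^^ j"
      by (auto simp: u_def)
    have "(\<gamma> ^^ i) c0 = (\<gamma> ^^ Suc j) c0"
      using u_c0[OF that(1)] u_c0[OF \<gamma>Q[OF that(1)]] ij by simp
    then show ?thesis
      using eq[of i "Suc j" x] that ij by simp
  qed
  \<comment> \<open>For \<open>y \<in> Q\<close> the diagonal orbit of \<open>(y, c)\<close>
    contains \<open>(c0, v y c)\<close>. Thus \<open>v y c\<close> is constant on that orbit and
    names the copy of \<open>Q\<close>.\<close>
  define v where "v = (\<lambda>y. inv_into C (u y))"
  have vC: "v y c \<in> C" if "c \<in> C" for y c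
    using bij_betwE[OF bij_betw_inv_into[OF bij_u]] that by (simp add: v_def)
  have uv: "u y (v y c) = c" if "c \<in> C" for y c
    using bij_betw_inv_into_right[OF bij_u that] by (simp add: v_def)
  have vu: "v y (u y c) = c" if "c \<in> C" for y c
    using bij_betw_inv_into_left[OF bij_u that] by (simp add: v_def)
  have uC: "u y c \<in> C" if "c \<in> C" for y c
    using bij_betwE[OF bij_u] that by blast
  have v_\<gamma>: "v (\<gamma> y) (\<gamma> c) = v y c" if "y \<in> Q" "c \<in> C" for y c
    using vu[OF vC[OF that(2)], of "\<gamma> y" y] u_\<gamma>[OF that(1) vC[OF that(2)]] uv[OF that(2)] by simp
  define n where "n = card C"
  obtain e where e: "bij_betw e C {0..<n}"
    using ex_bij_betw_finite_nat[OF \<open>finite C\<close>] by (auto simp: n_def)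
  define e' where "e' = inv_into C e"
  have e_less: "e c < n" "e' (e c) = c" if "c \<in> C" for c
    using bij_betwE[OF e] e that by (auto simp: e'_def bij_betw_inv_into_left)
  have e'_mem: "e' k \<in> C" "e (e' k) = k" if "k < n" for k
    using bij_betwE[OF bij_betw_inv_into[OF e]] e that by (auto simp: e'_def bij_betw_inv_into_right)
  \<comment> \<open>Over \<open>Q\<close> the layers move up by \<open>n\<close>, and the freed
    layers \<open>k < n\<close> receive the copies of \<open>Q\<close> in
    \<open>Q \<times> C\<close>, one each. Nothing moves over \<open>C - Q\<close>. The map
    \<open>g\<close> is the inverse.\<close>
  define f where "f = (\<lambda>(x, c). case x of
      Inl k \<Rightarrow> (if c \<in> Q then k + n else k, c)
    | Inr y \<Rightarrow> (e (v y c), y))"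
  define g where "g = (\<lambda>(k, c).
    if c \<notin> Q then (Inl k, c) else if k < n then (Inr c, u c (e' k)) else (Inl (k - n), c))"
  define \<alpha> where "\<alpha> = map_sum (id :: nat \<Rightarrow> nat) \<gamma>"
  show thesis
  proof (rule that[of Q f \<alpha>])
    show "bij_betw f ((UNIV <+> Q) \<times> C) (UNIV \<times> C)"
    proof (rule bij_betw_byWitness[where f' = g])
      show "\<forall>x\<in>(UNIV <+> Q) \<times> C. g (f x) = x"
        using e_less vC uv QC by (auto simp: f_def g_def)
      show "\<forall>x\<in>UNIV \<times> C. f (g x) = x"
        using e'_mem vu by (auto simp: f_def g_def)
      show "f ` ((UNIV <+> Q) \<times> C) \<subseteq> UNIV \<times> C"
        using QC by (auto simp: f_def)
      show "g ` (UNIV \<times> C) \<subseteq> (UNIV <+> Q) \<times> C"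
        using uC e'_mem by (auto simp: g_def split: if_splits)
    qed
    show "bij_betw \<alpha> (UNIV <+> Q) (UNIV <+> Q)"
      unfolding bij_betw_def
    proof
      show "inj_on \<alpha> (UNIV <+> Q)"
        using \<gamma> QC by (auto simp: \<alpha>_def inj_on_def bij_betw_def subset_iff)
      have "\<alpha> ` (UNIV <+> Q) = UNIV <+> \<gamma> ` Q"
        by (force simp: \<alpha>_def)
      then show "\<alpha> ` (UNIV <+> Q) = UNIV <+> Q"
        by (simp add: \<open>\<gamma> ` Q = Q\<close>)
    qed
    show "f (\<alpha> x, \<gamma> c) = map_prod id \<gamma> (f (x, c))" if "x \<in> UNIV <+> Q" "c \<in> C" for x c
      using that \<gamma>Q_iff v_\<gamma> by (auto simp: f_def \<alpha>_def)
  qed (use c0Q QC in \<open>auto simp: \<alpha>_def\<close>)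
qed

text \<open>Infinite universes leave room for the counterexample, whose sets are countably
  infinite.\<close>

theorem theorem5:
  fixes C :: "'c set" and \<Gamma> :: "('c \<Rightarrow> 'c) set"
  assumes "infinite (UNIV :: 'a set)" and "infinite (UNIV :: 'b set)"
    and "finite C" and "C \<noteq> {}"
    and "subgroup \<Gamma> (BijGroup C)"
  shows "fully_cancelling TYPE('a) TYPE('b) C \<Gamma> \<longleftrightarrow> \<Gamma> = {\<lambda>x\<in>C. x}"
proof
  assume fc: "fully_cancelling TYPE('a) TYPE('b) C \<Gamma>"
  show "\<Gamma> = {\<lambda>x\<in>C. x}"
  proof (rule ccontr)
    assume "\<Gamma> \<noteq> {\<lambda>x\<in>C. x}"
    then obtain \<gamma> c0 where \<gamma>: "\<gamma> \<in> \<Gamma>" and c0: "c0 \<in> C" "\<gamma> c0 \<noteq> c0"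
      and free: "\<And>k x. (\<gamma> ^^ k) c0 = c0 \<Longrightarrow> x \<in> C \<Longrightarrow> (\<gamma> ^^ k) x = x"
      using exists_free_orbit[OF assms(5,3)] by metis
    have sub: "\<Gamma> \<subseteq> Bij C"
      using subgroup.subset[OF assms(5)] by (simp add: BijGroup_def)
    then have "bij_betw \<gamma> C C"
      using \<gamma> by (auto simp: Bij_def)
    then obtain f :: "(nat + 'c) \<times> 'c \<Rightarrow> nat \<times> 'c" and Q \<alpha>
      where Q: "c0 \<in> Q" "Q \<subseteq> C" and f: "bij_betw f ((UNIV <+> Q) \<times> C) (UNIV \<times> C)"
        and \<alpha>: "bij_betw \<alpha> (UNIV <+> Q) (UNIV <+> Q)" "\<alpha> (Inr c0) = Inr (\<gamma> c0)"
        and eq: "\<And>x c. x \<in> UNIV <+> Q \<Longrightarrow> c \<in> C \<Longrightarrow> f (\<alpha> x, \<gamma> c) = map_prod id \<gamma> (f (x, c))"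
      using twisted_shift[OF assms(3) _ c0(1) free] by metis
    obtain s :: "nat \<Rightarrow> 'a" where s: "inj s"
      using infinite_countable_subset[OF assms(1)] by blast
    obtain t :: "nat \<Rightarrow> 'b" where t: "inj t"
      using infinite_countable_subset[OF assms(2)] by blast
    obtain e :: "'c \<Rightarrow> nat" where e: "inj_on e Q"
      using finite_imp_inj_to_nat_seg[OF finite_subset[OF Q(2) assms(3)]] by blast
    \<comment> \<open>Even indices of \<open>s\<close> hold the naturals and odd indices hold
      \<open>Q\<close>, so one injection embeds both summands.\<close>
    have "inj_on (case_sum (\<lambda>k. s (2 * k)) (\<lambda>y. s (2 * e y + 1))) (UNIV <+> Q)"
      by (auto simp: inj_on_def inj_eq[OF s] dest: inj_onD[OF e]) presburger+
    then have "\<not> fully_cancelling TYPE('a) TYPE('b) C \<Gamma>"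
      using Q c0 t by (intro not_fully_cancellingI[OF sub \<gamma> f \<alpha>(1) eq, of "Inr c0"]) (auto simp: \<alpha>(2))
    then show False
      using fc by blast
  qed
next
  assume "\<Gamma> = {\<lambda>x\<in>C. x}"
  then show "fully_cancelling TYPE('a) TYPE('b) C \<Gamma>"
    using fully_cancelling_trivial[OF assms(3,4)] by blast
qed

end
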